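(* Let $p$ be a prime and $\lambda$ a partition. For every ideal $I\subset P_\lambda$, $$|O_{p,I}|=p^{[I]}\prod_{x\in\max I}\bigl(1-p^{-m(x)}\bigr).$$
   Context: A partition is a non-increasing sequence $\lambda=(\lambda_1\geq\cdots\geq\lambda_l)$ of positive integers. $A_{p,\lambda}=\mathbf{Z}/p^{\lambda_1}\mathbf{Z}\oplus\cdots\oplus\mathbf{Z}/p^{\lambda_l}\mathbf{Z}$ and $G_{p,\lambda}$ is its automorphism group. Fundamental poset $P$: its elements are the symbols $(p^r,k)$ with integers $0\leq r<k$, where $(p^r,k)$ stands for the orbit of $p^r$ in $\mathbf{Z}/p^k\mathbf{Z}$ under automorphisms of $\mathbf{Z}/p^k\mathbf{Z}$, i.e. the set of elements $p^ru$ with $p\nmid u$. The partial order is: $(p^r,k)\geq(p^s,l)$ if and only if $r\leq s$ and $k-r\geq l-s$ (equivalently, some homomorphism $\mathbf{Z}/p^k\mathbf{Z}\to\mathbf{Z}/p^l\mathbf{Z}$ maps $p^r$ to $p^s$). $P_\lambda$ is the induced subposet consisting of the elements $(p^r,k)$ with $k=\lambda_i$ for some $i$. An ideal of a poset is a (possibly empty) down-closed subset; $\max I$ is the set of maximal elements of $I$. For $a=(a_1,\ldots,a_l)\in A_{p,\lambda}$, $I(a)$ is the ideal of $P$ generated by the orbits of the non-zero coordinates $a_i\in\mathbf{Z}/p^{\lambda_i}\mathbf{Z}$ ($a_i=p^ru\neq0$ with $p\nmid u$ contributes $(p^r,\lambda_i)$), and $I_\lambda(a)=I(a)\cap P_\lambda$.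 For an ideal $I$ of $P_\lambda$, $O_{p,I}=\{a\in A_{p,\lambda}: I_\lambda(a)=I\}$, which is the $G_{p,\lambda}$-orbit in $A_{p,\lambda}$ corresponding to $I$. For $x=(p^r,k)\in P_\lambda$, the multiplicity $m(x)$ is the number of times $k$ occurs in $\lambda$, and $[I]=\sum_{x\in I}m(x)$. *)

theory Defs
  imports "HOL-Algebra.Product_Groups" "HOL-Computational_Algebra.Primes" Complex_Main
begin

definition is_partition :: "nat list \<Rightarrow> bool" where
  "is_partition lam \<longleftrightarrow> sorted_wrt (\<ge>) lam \<and> (\<forall>k \<in> set lam. 0 < k)"

(* The parts of lam are indexed from 0, and a residue class is given by its
   representative in {0..<p ^ (lam ! i)}. *)
definition abelian_p_group :: "nat \<Rightarrow> nat list \<Rightarrow> (nat \<Rightarrow> int) monoid" where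
  "abelian_p_group p lam = product_group {..<length lam} (\<lambda>i. integer_mod_group (p ^ (lam ! i)))"

(* The pair (r, k) is the symbol (p^r, k), i.e. the orbit of p^r in Z/p^k Z
   under automorphisms. *)
type_synonym orbit_symbol = "nat \<times> nat"

definition fundamental_poset :: "orbit_symbol set" where
  "fundamental_poset = {(r, k). r < k}"

(* orbit_le (s, l) (r, k) means (p^s, l) \<le> (p^r, k); the differences are taken
   in int to avoid truncated subtraction. *)
fun orbit_le :: "orbit_symbol \<Rightarrow> orbit_symbol \<Rightarrow> bool" where
  "orbit_le (s, l) (r, k) \<longleftrightarrow> r \<le> s \<and> int l - int s \<le> int k - int r"

definition poset_of :: "nat list \<Rightarrow> orbit_symbol set" where
  "poset_of lam = {(r, k) \<in> fundamental_poset. k \<in> set lam}"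

definition ideal_of :: "orbit_symbol set \<Rightarrow> orbit_symbol set \<Rightarrow> bool" where
  "ideal_of I Q \<longleftrightarrow> I \<subseteq> Q \<and> (\<forall>x \<in> I. \<forall>y \<in> Q. orbit_le y x \<longrightarrow> y \<in> I)"

definition max_elems :: "orbit_symbol set \<Rightarrow> orbit_symbol set" where
  "max_elems I = {x \<in> I. \<forall>y \<in> I. orbit_le x y \<longrightarrow> y = x}"

definition coord_orbits :: "nat \<Rightarrow> nat list \<Rightarrow> (nat \<Rightarrow> int) \<Rightarrow> orbit_symbol set" where
  "coord_orbits p lam a =
     {(r, lam ! i) | r i. i < length lam \<and> a i \<noteq> 0 \<and> (\<exists>u. \<not> int p dvd u \<and> a i = int p ^ r * u)}"

definition ideal_gen :: "nat \<Rightarrow> nat list \<Rightarrow> (nat \<Rightarrow> int) \<Rightarrow> orbit_symbol set" where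
  "ideal_gen p lam a = {x \<in> fundamental_poset. \<exists>y \<in> coord_orbits p lam a. orbit_le x y}"

definition ideal_in :: "nat \<Rightarrow> nat list \<Rightarrow> (nat \<Rightarrow> int) \<Rightarrow> orbit_symbol set" where
  "ideal_in p lam a = ideal_gen p lam a \<inter> poset_of lam"

definition orbit_of_ideal :: "nat \<Rightarrow> nat list \<Rightarrow> orbit_symbol set \<Rightarrow> (nat \<Rightarrow> int) set" where
  "orbit_of_ideal p lam I = {a \<in> carrier (abelian_p_group p lam). ideal_in p lam a = I}"

definition mult_of :: "nat list \<Rightarrow> orbit_symbol \<Rightarrow> nat" where
  "mult_of lam x = count_list lam (snd x)"

definition weight :: "nat list \<Rightarrow> orbit_symbol set \<Rightarrow> nat" where
  "weight lam I = (\<Sum>x\<in>I. mult_of lam x)"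

end

(* Writing (t k, k) for the generator of the column of I over the part k, a point a lies in the
   orbit iff every coordinate a_i is divisible by p^(t k), where k = lambda_i, and every maximal
   element (t k, k) is attained exactly by some coordinate with lambda_i = k.  The first condition
   describes a product of sets of sizes p^(k - t k), whose total size is p^[I].  Each maximal
   element then excludes the points with all coordinates over k divisible by p^(t k + 1), a
   proportion p^(-m) of the whole, independently for different k. *)
theory Submission
  imports Defs
begin

section \<open>Inclusion-exclusion in a product over fibres\<close>

text \<open>Induction on \<open>M\<close>. The tuples that violate only the condition at a new
  \<open>k\<close> form a set of the same kind, for the family shrunk to \<open>C\<close> on the
  fibre over \<open>k\<close>. Shrinking multiplies the product of sizes by \<open>q\<close> to the
  size of that fibre, so subtraction gives the factor for \<open>k\<close>. This is why
  \<open>B\<close> has to vary in the induction.\<close>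

lemma card_PiE_fibrewise_not_all_in:
  fixes q :: real
  assumes "finite M" and "finite J" and "\<And>i. i \<in> J \<Longrightarrow> finite (B i)"
    and "\<And>i. i \<in> J \<Longrightarrow> f i \<in> M \<Longrightarrow> C i \<subseteq> B i \<and> real (card (C i)) = q * real (card (B i))"
  shows "real (card {a \<in> Pi\<^sub>E J B. \<forall>k\<in>M. \<exists>i\<in>J. f i = k \<and> a i \<notin> C i}) =
    (\<Prod>i\<in>J. real (card (B i))) * (\<Prod>k\<in>M. 1 - q ^ card {i\<in>J. f i = k})"
  using assms
proof (induction M arbitrary: B rule: finite_induct)
  case empty
  then show ?case by (simp add: card_PiE)
next
  case (insert k M)
  define S where "S B = {a \<in> Pi\<^sub>E J B. \<forall>k\<in>M. \<exists>i\<in>J. f i = k \<and> a i \<notin> C i}" for B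
  \<comment> \<open>On the fibres over \<open>M\<close> this family agrees with \<open>B\<close>,
    since \<open>k\<close> is not in \<open>M\<close>; so the induction hypothesis applies to it as
    well.\<close>
  define B' where "B' i = (if f i = k then C i else B i)" for i
  have C: "C i \<subseteq> B i \<and> real (card (C i)) = q * real (card (B i))"
    if "i \<in> J" "f i \<in> insert k M" for i
    using insert.prems(3) that by blast
  have IH: "real (card (S B)) =
      (\<Prod>i\<in>J. real (card (B i))) * (\<Prod>k\<in>M. 1 - q ^ card {i\<in>J. f i = k})"
    unfolding S_def by (rule insert.IH) (use insert.prems in auto)
  have IH': "real (card (S B')) =
      (\<Prod>i\<in>J. real (card (B' i))) * (\<Prod>k\<in>M. 1 - q ^ card {i\<in>J. f i = k})"
    unfolding S_def
  proof (rule insert.IH)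
    show "finite (B' i)" if "i \<in> J" for i
      using that C[of i] insert.prems(2)[OF that] by (auto simp: B'_def intro: finite_subset)
    show "C i \<subseteq> B' i \<and> real (card (C i)) = q * real (card (B' i))" if "i \<in> J" "f i \<in> M" for i
      using that C[of i] insert.hyps by (auto simp: B'_def)
  qed (use insert.prems in auto)
  have "(\<Prod>i\<in>J. real (card (B' i))) = (\<Prod>i\<in>J. (if f i = k then q else 1) * real (card (B i)))"
    by (rule prod.cong) (use C in \<open>auto simp: B'_def\<close>)
  also have "\<dots> = q ^ card {i\<in>J. f i = k} * (\<Prod>i\<in>J. real (card (B i)))"
    using insert.prems(1) by (simp add: prod.distrib flip: prod.inter_filter)
  finally have B': "(\<Prod>i\<in>J. real (card (B' i))) =
      q ^ card {i\<in>J. f i = k} * (\<Prod>i\<in>J. real (card (B i)))" .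
  have "Pi\<^sub>E J B' \<subseteq> Pi\<^sub>E J B"
    by (rule PiE_mono) (use C in \<open>auto simp: B'_def\<close>)
  then have sub: "S B' \<subseteq> S B"
    by (auto simp: S_def)
  have fin: "finite (S B)"
    unfolding S_def by (rule finite_subset[OF _ finite_PiE[OF insert.prems(1,2)]]) auto
  have "a \<in> Pi\<^sub>E J B' \<longleftrightarrow> (\<forall>i\<in>J. f i = k \<longrightarrow> a i \<in> C i)" if "a \<in> Pi\<^sub>E J B" for a
    using that by (auto simp: B'_def PiE_iff)
  then have "{a \<in> Pi\<^sub>E J B. \<forall>k\<in>insert k M. \<exists>i\<in>J. f i = k \<and> a i \<notin> C i} = S B - S B'"
    by (auto simp: S_def)
  then have "real (card {a \<in> Pi\<^sub>E J B. \<forall>k\<in>insert k M. \<exists>i\<in>J. f i = k \<and> a i \<notin> C i}) =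
      real (card (S B)) - real (card (S B'))"
    using sub fin by (simp add: card_Diff_subset finite_subset card_mono of_nat_diff)
  then show ?case
    using insert.hyps by (simp add: IH IH' B' algebra_simps)
qed

section \<open>Powers of p dividing an integer\<close>

lemma card_multiples_power:
  fixes p :: nat
  assumes "0 < p" and "t \<le> k"
  shows "card {x \<in> {0..<int (p ^ k)}. int p ^ t dvd x} = p ^ (k - t)"
proof -
  have pk: "int (p ^ k) = int p ^ t * int p ^ (k - t)"
    using assms by (simp flip: power_add)
  have "0 < int p ^ t" using assms by simp
  then have pos: "0 \<le> int p ^ t * x \<longleftrightarrow> 0 \<le> x" "int p ^ t * x < int p ^ t * y \<longleftrightarrow> x < y" for x y
    by (simp_all only: zero_le_mult_iff mult_less_cancel_left_pos) linarith
  have "{x \<in> {0..<int (p ^ k)}. int p ^ t dvd x} = (*) (int p ^ t) ` {0..<int p ^ (k - t)}"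
    unfolding pk using pos by (auto elim!: dvdE)
  moreover have "inj_on ((*) (int p ^ t)) {0..<int p ^ (k - t)}"
    using assms by (auto simp: inj_on_def)
  ultimately show ?thesis
    by (simp add: card_image nat_power_eq)
qed

text \<open>Guarantees that a non-zero coordinate contributes only one symbol to
  \<open>coord_orbits\<close>.\<close>

lemma exact_power_unique:
  fixes p :: int
  assumes "p \<noteq> 0" "\<not> p dvd u" "\<not> p dvd v" "p ^ r * u = p ^ s * v"
  shows "r = s"
proof -
  have "\<not> r < s" if "\<not> p dvd u" "p ^ r * u = p ^ s * v" for r s u v
  proof
    assume "r < s"
    then have "p ^ s = p ^ r * (p * p ^ (s - r - 1))"
      by (simp flip: power_Suc power_add)
    with that assms(1) show False by auto
  qed
  from this[of u r s v] this[of v s r u] assms show ?thesis by simp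
qed

lemma exact_power_exists:
  fixes x :: int
  assumes "prime p" "x \<noteq> 0"
  obtains r u where "\<not> int p dvd u" "x = int p ^ r * u"
  using multiplicity_decompose'[of x "int p"] assms
  by (metis not_prime_unit prime_nat_int_transfer)

lemma power_dvd_exact_iff:
  fixes p :: int
  assumes "p \<noteq> 0" "\<not> p dvd u"
  shows "p ^ t dvd p ^ r * u \<longleftrightarrow> t \<le> r"
proof
  show "t \<le> r" if "p ^ t dvd p ^ r * u"
  proof (rule ccontr)
    assume "\<not> t \<le> r"
    then have "p ^ Suc r dvd p ^ t" by (intro le_imp_power_dvd) simp
    with that have "p ^ r * p dvd p ^ r * u" by (metis dvd_trans power_Suc2)
    with assms show False by simp
  qed
qed (simp add: le_imp_power_dvd dvd_mult2)

section \<open>Multiplicities, maximal elements and columns of ideals\<close>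

lemma mult_of_eq_card: "mult_of lam x = card {i \<in> {..<length lam}. lam ! i = snd x}"
  by (simp add: mult_of_def count_list_eq_length_filter length_filter_conv_card eq_commute)

lemma finite_poset_of: "finite (poset_of lam)"
proof -
  have "poset_of lam \<subseteq> {..<Suc (Max (set lam))} \<times> set lam"
    by (auto simp: poset_of_def fundamental_poset_def less_Suc_eq_le
        intro!: order.trans[OF less_imp_le Max_ge])
  then show ?thesis by (rule finite_subset) simp
qed

lemma orbit_le_refl: "orbit_le x x"
  by (cases x) simp

lemma orbit_le_trans: "orbit_le x y \<Longrightarrow> orbit_le y z \<Longrightarrow> orbit_le x z"
  by (cases x; cases y; cases z) auto

lemma ex_max_elem_above:
  assumes "finite I" "x \<in> I"
  shows "\<exists>y\<in>max_elems I. orbit_le x y"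
proof -
  \<comment> \<open>This rank is strictly increasing for the order, as k - 2r = (k - r) - r.\<close>
  define rank where "rank = (\<lambda>(r, k). int k - 2 * int r)"
  define U where "U = {y \<in> I. orbit_le x y}"
  have "finite (rank ` U)" "rank ` U \<noteq> {}"
    using assms orbit_le_refl[of x] unfolding U_def by (simp, blast)
  then obtain y where y: "y \<in> U" "rank y = Max (rank ` U)"
    using Max_in by (metis (no_types, lifting) imageE)
  have "z = y" if "z \<in> I" "orbit_le y z" for z
  proof -
    have "z \<in> U" using that y(1) orbit_le_trans[of x y z] by (simp add: U_def)
    then have "rank z \<le> rank y" using y(2) \<open>finite (rank ` U)\<close> by simp
    with \<open>orbit_le y z\<close> show ?thesis by (cases y; cases z) (auto simp: rank_def)
  qed
  with y(1) show ?thesis unfolding U_def max_elems_def by blast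
qed

text \<open>A maximal element of \<open>I\<close> lying below a generator in \<open>I\<close> is
  that generator; conversely, by finiteness every element of \<open>I\<close> lies below a maximal
  one. This replaces equality of ideals by conditions on single coordinates, which can be
  counted.\<close>

lemma ideal_in_eq_iff:
  assumes I: "ideal_of I (poset_of lam)" and coord: "coord_orbits p lam a \<subseteq> poset_of lam"
  shows "ideal_in p lam a = I \<longleftrightarrow> coord_orbits p lam a \<subseteq> I \<and> max_elems I \<subseteq> coord_orbits p lam a"
proof -
  have fin: "finite I"
    using I finite_poset_of finite_subset by (auto simp: ideal_of_def)
  have eq: "ideal_in p lam a = {x \<in> poset_of lam. \<exists>y \<in> coord_orbits p lam a. orbit_le x y}"
    by (auto simp: ideal_in_def ideal_gen_def poset_of_def)
  show ?thesis
  proof (intro iffI conjI)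
    assume *: "ideal_in p lam a = I"
    then show sub: "coord_orbits p lam a \<subseteq> I"
      using coord orbit_le_refl by (auto simp: eq)
    show "max_elems I \<subseteq> coord_orbits p lam a"
    proof
      fix x assume x: "x \<in> max_elems I"
      then have "x \<in> ideal_in p lam a" by (simp add: * max_elems_def)
      then obtain y where "y \<in> coord_orbits p lam a" "orbit_le x y" by (auto simp: eq)
      with x sub show "x \<in> coord_orbits p lam a" by (auto simp: max_elems_def)
    qed
  next
    assume *: "coord_orbits p lam a \<subseteq> I \<and> max_elems I \<subseteq> coord_orbits p lam a"
    have "x \<in> I" if "x \<in> ideal_in p lam a" for x
      using that * I unfolding eq ideal_of_def by blast
    moreover have "x \<in> ideal_in p lam a" if "x \<in> I" for x
      using ex_max_elem_above[OF fin that] that * I unfolding eq ideal_of_def by blast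
    ultimately show "ideal_in p lam a = I" by blast
  qed
qed

text \<open>Over a fixed part \<open>k\<close> the order is the reversed order of exponents, so an
  ideal meets this chain in a final segment of exponents. The value \<open>t = k\<close> encodes an
  empty column.\<close>

lemma ideal_column:
  assumes I: "ideal_of I (poset_of lam)" and k: "k \<in> set lam"
  shows "\<exists>t\<le>k. \<forall>r. (r, k) \<in> I \<longleftrightarrow> t \<le> r \<and> r < k"
proof (intro exI conjI allI)
  \<comment> \<open>The disjunct \<open>k \<le> r\<close> keeps the minimum well defined for an
    empty column and makes it \<open>k\<close> there.\<close>
  let ?t = "LEAST r. k \<le> r \<or> (r, k) \<in> I"
  show "?t \<le> k" by (rule Least_le) simp
  have t: "k \<le> ?t \<or> (?t, k) \<in> I" by (rule LeastI[of _ k]) simp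
  fix r
  have "r < k" if "(r, k) \<in> I"
    using that I by (auto simp: ideal_of_def poset_of_def fundamental_poset_def)
  moreover have "(r, k) \<in> I" if "?t \<le> r" "r < k"
  proof -
    have "(?t, k) \<in> I" "orbit_le (r, k) (?t, k)" using t that by auto
    moreover have "(r, k) \<in> poset_of lam"
      using that k by (auto simp: poset_of_def fundamental_poset_def)
    ultimately show ?thesis using I unfolding ideal_of_def by blast
  qed
  ultimately show "(r, k) \<in> I \<longleftrightarrow> ?t \<le> r \<and> r < k"
    by (auto intro: Least_le)
qed

section \<open>Counting the orbit\<close>

theorem theorem8p5:
  fixes p :: nat and lam :: "nat list" and I :: "orbit_symbol set"
  assumes "prime p"
    and "is_partition lam"
    and "ideal_of I (poset_of lam)"
  shows "real (card (orbit_of_ideal p lam I)) =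
    real p ^ weight lam I * (\<Prod>x\<in>max_elems I. 1 - real p powi (- int (mult_of lam x)))"
proof -
  note I = assms(3)
  have p0: "0 < p" using assms(1) by (rule prime_gt_0_nat)
  have IP: "I \<subseteq> poset_of lam" and fin: "finite I"
    using I finite_poset_of finite_subset by (auto simp: ideal_of_def)
  obtain t where t: "\<And>k. k \<in> set lam \<Longrightarrow> t k \<le> k"
    and t_iff: "\<And>k r. k \<in> set lam \<Longrightarrow> (r, k) \<in> I \<longleftrightarrow> t k \<le> r \<and> r < k"
    using ideal_column[OF I] by metis
  define J where "J = {..<length lam}"
  define X where "X s i = {x \<in> {0..<int (p ^ (lam ! i))}. int p ^ s dvd x}" for s i
  \<comment> \<open>\<open>B i\<close> holds 0 and the residues whose symbol lies in
    \<open>I\<close>; \<open>C i\<close> leaves out those whose symbol is the top of its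
    column.\<close>
  define B where "B i = X (t (lam ! i)) i" for i
  define C where "C i = X (Suc (t (lam ! i))) i" for i
  have J: "lam ! i \<in> set lam" if "i \<in> J" for i
    using that by (simp add: J_def)
  have carrier: "carrier (abelian_p_group p lam) = (\<Pi>\<^sub>E i\<in>J. {0..<int (p ^ (lam ! i))})"
    using p0 by (simp add: abelian_p_group_def J_def carrier_integer_mod_group)
  \<comment> \<open>The column top \<open>(t k, k)\<close> lies above every element of
    \<open>I\<close> over \<open>k\<close>, so each part carries at most one maximal
    element.\<close>
  have max_t: "r = t k \<and> t k < k \<and> k \<in> set lam" if "(r, k) \<in> max_elems I" for r k
  proof -
    have "(r, k) \<in> I" and max: "\<And>y. y \<in> I \<Longrightarrow> orbit_le (r, k) y \<Longrightarrow> y = (r, k)"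
      using that by (auto simp: max_elems_def)
    moreover have k: "k \<in> set lam"
      using IP \<open>(r, k) \<in> I\<close> by (auto simp: poset_of_def)
    ultimately show ?thesis
      using max[of "(t k, k)"] t_iff[OF k, of r] t_iff[OF k, of "t k"] by auto
  qed
  \<comment> \<open>The representative of a non-zero residue is positive and below p^k, which bounds
    the power of p dividing it.\<close>
  have exponent_less: "r < k" if "a = int p ^ r * u" "a \<noteq> 0" "a \<in> {0..<int (p ^ k)}" for a r u k
  proof -
    have "0 < a" using that(2,3) by auto
    then have "int p ^ r \<le> a" using that(1) by (intro zdvd_imp_le) auto
    with that(3) have "p ^ r < p ^ k" by (simp flip: of_nat_power)
    then show ?thesis
      by (rule power_less_imp_less_exp[OF prime_gt_1_nat[OF assms(1)]])
  qed
  have mem_iff: "a \<in> orbit_of_ideal p lam I \<longleftrightarrow>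
      a \<in> Pi\<^sub>E J B \<and> (\<forall>k\<in>snd ` max_elems I. \<exists>i\<in>J. lam ! i = k \<and> a i \<notin> C i)" for a
  proof (cases "a \<in> carrier (abelian_p_group p lam)")
    case False
    moreover have "Pi\<^sub>E J B \<subseteq> carrier (abelian_p_group p lam)"
      unfolding carrier by (rule PiE_mono) (auto simp: B_def X_def)
    ultimately show ?thesis by (auto simp: orbit_of_ideal_def)
  next
    case True
    have a: "a i \<in> {0..<int (p ^ (lam ! i))}" if "i \<in> J" for i
      using True that by (auto simp: carrier)
    have coord: "coord_orbits p lam a \<subseteq> poset_of lam"
    proof
      fix x assume "x \<in> coord_orbits p lam a"
      then obtain r i u where "x = (r, lam ! i)" "i \<in> J" "a i \<noteq> 0" "a i = int p ^ r * u"
        by (auto simp: coord_orbits_def J_def)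
      moreover from this have "r < lam ! i" using a by (blast intro: exponent_less)
      ultimately show "x \<in> poset_of lam"
        using J by (simp add: poset_of_def fundamental_poset_def)
    qed
    \<comment> \<open>A zero coordinate has no symbol and lies in every \<open>B i\<close>;
      otherwise the exponent \<open>r\<close> is unique and only has to be compared with
      \<open>t (lam ! i)\<close>.\<close>
    have B_iff: "a i \<in> B i \<longleftrightarrow>
        (\<forall>r u. a i \<noteq> 0 \<and> \<not> int p dvd u \<and> a i = int p ^ r * u \<longrightarrow> (r, lam ! i) \<in> I)"
      if "i \<in> J" for i
    proof (cases "a i = 0")
      case True
      with p0 show ?thesis by (simp add: B_def X_def)
    next
      case False
      then obtain r u where ru: "\<not> int p dvd u" "a i = int p ^ r * u"
        by (rule exact_power_exists[OF assms(1)])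
      have "r < lam ! i" using exponent_less[OF ru(2) False a[OF that]] .
      moreover have "s = r" if "\<not> int p dvd v" "a i = int p ^ s * v" for s v
        using exact_power_unique[of "int p" v u s r] that ru p0 by simp
      moreover have "int p ^ t (lam ! i) dvd a i \<longleftrightarrow> t (lam ! i) \<le> r"
        using power_dvd_exact_iff[of "int p" u] ru p0 by simp
      ultimately show ?thesis
        using a[OF that] t_iff[OF J[OF that]] ru False by (auto simp: B_def X_def)
    qed
    have "a \<in> Pi\<^sub>E J B \<longleftrightarrow> (\<forall>i\<in>J. a i \<in> B i)"
      using True by (auto simp: carrier PiE_iff)
    also have "\<dots> \<longleftrightarrow> coord_orbits p lam a \<subseteq> I"
      by (auto simp: B_iff coord_orbits_def J_def)
    finally have 1: "a \<in> Pi\<^sub>E J B \<longleftrightarrow> coord_orbits p lam a \<subseteq> I" .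
    \<comment> \<open>After the power guaranteed by \<open>B i\<close> is split off,
      \<open>C i\<close> asks for one more factor p in the cofactor \<open>u\<close>. Zero has
      cofactor 0 and hence lies in \<open>C i\<close>.\<close>
    have exact: "a i \<notin> C i \<longleftrightarrow> a i \<noteq> 0 \<and> (\<exists>u. \<not> int p dvd u \<and> a i = int p ^ t (lam ! i) * u)"
      if "i \<in> J" "a i \<in> B i" for i
    proof -
      have "int p ^ t (lam ! i) dvd a i" using that(2) by (simp add: B_def X_def)
      then obtain u where u: "a i = int p ^ t (lam ! i) * u" by (rule dvdE)
      have "a i \<in> C i \<longleftrightarrow> int p dvd u"
        using a[OF that(1)] p0 by (simp add: C_def X_def u power_Suc2 del: power_Suc)
      with u p0 show ?thesis by auto
    qed
    have 2: "(\<exists>i\<in>J. lam ! i = snd x \<and> a i \<notin> C i) \<longleftrightarrow> x \<in> coord_orbits p lam a"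
      if "a \<in> Pi\<^sub>E J B" "x \<in> max_elems I" for x
    proof -
      have "a i \<in> B i" if "i \<in> J" for i using \<open>a \<in> Pi\<^sub>E J B\<close> that by auto
      then show ?thesis
        using exact max_t[of "fst x" "snd x"] that(2) by (cases x) (auto simp: coord_orbits_def J_def)
    qed
    show ?thesis
    proof (cases "a \<in> Pi\<^sub>E J B")
      case False
      with 1 show ?thesis by (simp add: orbit_of_ideal_def ideal_in_eq_iff[OF I coord])
    next
      case B: True
      have "(\<forall>k\<in>snd ` max_elems I. \<exists>i\<in>J. lam ! i = k \<and> a i \<notin> C i) \<longleftrightarrow>
          (\<forall>x\<in>max_elems I. x \<in> coord_orbits p lam a)"
        using 2[OF B] by simp
      with 1 B True show ?thesis
        by (simp add: orbit_of_ideal_def ideal_in_eq_iff[OF I coord] subset_eq)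
    qed
  qed
  have cardB: "card (B i) = p ^ (lam ! i - t (lam ! i))" if "i \<in> J" for i
    using card_multiples_power[OF p0 t[OF J[OF that]]] by (simp add: B_def X_def)
  have "real (card (orbit_of_ideal p lam I)) =
      real (card {a \<in> Pi\<^sub>E J B. \<forall>k\<in>snd ` max_elems I. \<exists>i\<in>J. lam ! i = k \<and> a i \<notin> C i})"
    by (rule arg_cong[where f = "\<lambda>A. real (card A)"]) (use mem_iff in blast)
  also have "\<dots> = (\<Prod>i\<in>J. real (card (B i))) *
      (\<Prod>k\<in>snd ` max_elems I. 1 - (1 / real p) ^ card {i\<in>J. lam ! i = k})"
  proof (rule card_PiE_fibrewise_not_all_in)
    show "finite (snd ` max_elems I)"
      using fin by (simp add: max_elems_def)
    show "finite (B i)" for i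
      unfolding B_def X_def by (rule finite_subset[OF _ finite_atLeastLessThan_int]) auto
    show "C i \<subseteq> B i \<and> real (card (C i)) = 1 / real p * real (card (B i))"
      if i: "i \<in> J" "lam ! i \<in> snd ` max_elems I" for i
    proof
      \<comment> \<open>The ratio 1/p needs a non-empty column: for
        \<open>t (lam ! i) = lam ! i\<close> both \<open>B i\<close> and \<open>C i\<close> would be
        the set of 0 alone.\<close>
      have lt: "t (lam ! i) < lam ! i" using i(2) max_t by (metis imageE prod.collapse)
      then have "lam ! i - t (lam ! i) = Suc (lam ! i - Suc (t (lam ! i)))" by simp
      moreover have "card (C i) = p ^ (lam ! i - Suc (t (lam ! i)))"
        unfolding C_def X_def by (rule card_multiples_power[OF p0]) (use lt in simp)
      ultimately show "real (card (C i)) = 1 / real p * real (card (B i))"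
        using p0 by (simp add: cardB[OF i(1)])
      show "C i \<subseteq> B i"
        by (auto simp: B_def C_def X_def intro: dvd_mult_right)
    qed
  qed (simp add: J_def)
  also have "(\<Prod>i\<in>J. real (card (B i))) = real p ^ weight lam I"
  proof -
    \<comment> \<open>Double counting of the pairs of an element of \<open>I\<close> and an index of
      its part: each index \<open>i\<close> sees the whole column over
      \<open>lam ! i\<close>.\<close>
    have "weight lam I = (\<Sum>x\<in>I. \<Sum>i\<in>J. if lam ! i = snd x then 1 else 0)"
      by (simp add: weight_def mult_of_eq_card J_def flip: sum.inter_filter)
    also have "\<dots> = (\<Sum>i\<in>J. \<Sum>x\<in>I. if lam ! i = snd x then 1 else 0)"
      by (rule sum.swap)
    also have "\<dots> = (\<Sum>i\<in>J. lam ! i - t (lam ! i))"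
    proof (rule sum.cong[OF refl])
      fix i assume "i \<in> J"
      then have "{x \<in> I. lam ! i = snd x} = {t (lam ! i)..<lam ! i} \<times> {lam ! i}"
        using t_iff[OF J] by auto
      then show "(\<Sum>x\<in>I. if lam ! i = snd x then 1 else 0) = lam ! i - t (lam ! i)"
        using fin by (simp add: card_cartesian_product flip: sum.inter_filter)
    qed
    finally show ?thesis by (simp add: cardB power_sum)
  qed
  also have "(\<Prod>k\<in>snd ` max_elems I. 1 - (1 / real p) ^ card {i\<in>J. lam ! i = k}) =
      (\<Prod>x\<in>max_elems I. 1 - real p powi (- int (mult_of lam x)))"
  proof -
    \<comment> \<open>A maximal element is determined by its part, so the product over parts can be
      reindexed by maximal elements without merging factors.\<close>
    have "inj_on snd (max_elems I)"
      using max_t by (intro inj_onI) (metis prod.collapse)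
    then show ?thesis
      by (simp add: prod.reindex mult_of_eq_card J_def power_int_minus power_one_over inverse_eq_divide)
  qed
  finally show ?thesis .
qed

end
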